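(* Fix integers $n\ge d\geq 1$ and suppose $A_1,\dots,A_{n+1}$ is a cover of the sphere $S^d$ by $n+1$ sets such that the first $n$ sets $A_1,\dots, A_n$ are each open or closed. Furthermore, suppose that any subset of the sphere of diameter at most $c_n(S^d)$ is contained in some $A_i$. (In particular, this is satisfied if every subset of the sphere of diameter at most $\pi-p_{n+1}(\mathbb{R}P^d)$ is contained in some $A_i$.) Then there is at least one set $A_i$ containing a pair of antipodal points.
   Context: $S^d\subset\mathbb{R}^{d+1}$ is the unit sphere with the geodesic (angular) metric $d(x,y)=\arccos\langle x,y\rangle$; diameters are in this metric. For a compact metric space $X$ with a free $\mathbb{Z}/2$-action $x\mapsto -x$, the $\mathbb{Z}/2$-Carath\'eodory number $c_n(X)$ is the infimum over all $t\in[0,\infty)$ such that for every continuous odd map $f\colon X\to\mathbb{R}^n$ (i.e. $f(-x)=-f(x)$) there is a set $A\subset X$ with $\mathrm{diam}(A)\le t$ and $0\in\mathrm{conv}(f(A))$. $\mathbb{R}P^d$ carries the metric in which the distance between two points is the angle in $[0,\pi/2]$ between the corresponding lines in $\mathbb{R}^{d+1}$. For a compact metric space $(X,d)$ and $m\ge 1$, $p_m(X)=\sup\{\varepsilon>0 : \text{there are } x_1,\dots,x_m\in X \text{ with } d(x_i,x_j)\ge\varepsilon \text{ for all } i\ne j\}$. *)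

theory Defs
  imports "HOL-Analysis.Analysis"
begin

definition mdiameter :: "'a metric \<Rightarrow> 'a set \<Rightarrow> real" where
  "mdiameter X A = (if A = {} then 0 else SUP (x, y)\<in>A \<times> A. mdist X x y)"

text \<open>
  The number \<open>c\<^sub>n(X)\<close> of the space \<open>X\<close> with the involution \<open>\<nu>\<close>.  The dimension \<open>n\<close> of the target is
  \<open>CARD('n)\<close>.
\<close>

definition Z2_caratheodory ::
  "'n::finite itself \<Rightarrow> 'a metric \<Rightarrow> ('a \<Rightarrow> 'a) \<Rightarrow> real" where
  "Z2_caratheodory _ X \<nu> =
     Inf {t. 0 \<le> t \<and>
       (\<forall>f :: 'a \<Rightarrow> real^'n.
          continuous_map (mtopology_of X) euclidean f \<and> (\<forall>x\<in>mspace X. f (\<nu> x) = - f x)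
          \<longrightarrow> (\<exists>A. A \<subseteq> mspace X \<and> mdiameter X A \<le> t \<and> 0 \<in> convex hull (f ` A)))}"

definition packing_number :: "nat \<Rightarrow> 'a metric \<Rightarrow> real" where
  "packing_number m X =
     Sup {\<epsilon>. 0 < \<epsilon> \<and>
       (\<exists>x :: nat \<Rightarrow> 'a. (\<forall>i\<in>{1..m}. x i \<in> mspace X) \<and>
          (\<forall>i\<in>{1..m}. \<forall>j\<in>{1..m}. i \<noteq> j \<longrightarrow> \<epsilon> \<le> mdist X (x i) (x j)))}"

text \<open>
  The locale \<^locale>\<open>Metric_space\<close> requires the distance function to be nonnegative and symmetric on
  the whole type, so the two distances below are set to \<open>0\<close> outside the carriers.
\<close>

definition sphere_dist :: "'a::real_inner \<Rightarrow> 'a \<Rightarrow> real" where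
  "sphere_dist x y = (if x \<in> sphere 0 1 \<and> y \<in> sphere 0 1 then arccos (x \<bullet> y) else 0)"

definition sphere_metric :: "'a::real_inner metric" where
  "sphere_metric = metric (sphere 0 1, sphere_dist)"

text \<open>
  Points of real projective space are the lines through the origin.  Two lines have two angles
  between unit direction vectors, \<open>\<theta>\<close> and \<open>\<pi> - \<theta>\<close>; their distance is the one in \<open>[0, \<pi>/2]\<close>.
\<close>

definition lines_through_0 :: "'a::real_inner set set" where
  "lines_through_0 = (\<lambda>x. span {x}) ` sphere 0 1"

definition line_angle :: "'a::real_inner set \<Rightarrow> 'a set \<Rightarrow> real" where
  "line_angle K L =
     (if K \<in> lines_through_0 \<and> L \<in> lines_through_0
      then THE \<theta>. \<theta> \<in> {0..pi/2} \<and>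
             (\<exists>x\<in>K \<inter> sphere 0 1. \<exists>y\<in>L \<inter> sphere 0 1. \<theta> = arccos (x \<bullet> y))
      else 0)"

definition projective_metric :: "'a::real_inner set metric" where
  "projective_metric = metric (lines_through_0, line_angle)"

text \<open>
  Since \<^typ>\<open>'a metric\<close> is a subtype, \<^const>\<open>sphere_metric\<close> and \<^const>\<open>projective_metric\<close> have the
  intended carriers and distances only because the metric axioms hold.
\<close>

lemma abs_inner_unit_le_1:
  fixes x y :: "'a::real_inner"
  assumes "norm x = 1" "norm y = 1"
  shows "\<bar>x \<bullet> y\<bar> \<le> 1"
  using Cauchy_Schwarz_ineq2[of x y] assms by simp

lemma inner_unit_eq_1:
  fixes x y :: "'a::real_inner"
  assumes "norm x = 1" "norm y = 1" "x \<bullet> y = 1"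
  shows "x = y"
proof -
  have "x \<bullet> x = 1" "y \<bullet> y = 1" using assms by (simp_all add: dot_square_norm)
  then have "(x - y) \<bullet> (x - y) = 0"
    using assms(3) by (simp add: inner_diff inner_commute)
  then show ?thesis by simp
qed

lemma arccos_inner_triangle:
  fixes x y z :: "'a::real_inner"
  assumes "norm x = 1" "norm y = 1" "norm z = 1"
  shows "arccos (x \<bullet> z) \<le> arccos (x \<bullet> y) + arccos (y \<bullet> z)"
proof -
  define a b where "a = arccos (x \<bullet> y)" and "b = arccos (y \<bullet> z)"
  have xy: "\<bar>x \<bullet> y\<bar> \<le> 1" and yz: "\<bar>y \<bullet> z\<bar> \<le> 1" and xz: "\<bar>x \<bullet> z\<bar> \<le> 1"
    using assms by (simp_all add: abs_inner_unit_le_1)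
  have ab: "0 \<le> a" "a \<le> pi" "0 \<le> b" "b \<le> pi" and cs: "cos a = x \<bullet> y" "cos b = y \<bullet> z"
    using xy yz by (auto simp: a_def b_def abs_le_iff arccos_lbound arccos_ubound)
  have sq: "x \<bullet> x = 1" "y \<bullet> y = 1" "z \<bullet> z = 1"
    using assms by (simp_all add: dot_square_norm)
  show ?thesis
  proof (cases "pi \<le> a + b")
    case True
    then show ?thesis using arccos_ubound[of "x \<bullet> z"] xz by (auto simp: a_def b_def abs_le_iff)
  next
    case False
    define u v where "u = x - (x \<bullet> y) *\<^sub>R y" and "v = z - (y \<bullet> z) *\<^sub>R y"
    have uu: "u \<bullet> u = (sin a)\<^sup>2" and vv: "v \<bullet> v = (sin b)\<^sup>2"
      using sq by (simp_all add: u_def v_def inner_diff inner_commute sin_squared_eq cs flip: power2_eq_square)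
    have "norm u = sin a" "norm v = sin b"
      using ab by (simp_all add: norm_eq_sqrt_inner uu vv real_sqrt_abs sin_ge_zero)
    then have "- (sin a * sin b) \<le> u \<bullet> v"
      using Cauchy_Schwarz_ineq2[of u v] by (simp add: abs_le_iff)
    moreover have "u \<bullet> v = x \<bullet> z - cos a * cos b"
      using sq by (simp add: u_def v_def inner_diff inner_commute cs algebra_simps)
    ultimately have "cos (a + b) \<le> x \<bullet> z" by (simp add: cos_add)
    then have "arccos (x \<bullet> z) \<le> arccos (cos (a + b))"
      using xz by (intro arccos_le_arccos) (auto simp: abs_le_iff)
    also have "\<dots> = a + b" using False ab by (intro arccos_cos) auto
    finally show ?thesis by (simp add: a_def b_def)
  qed
qed

lemma arccos_inner_eq_0_iff:
  fixes x y :: "'a::real_inner"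
  assumes "norm x = 1" "norm y = 1"
  shows "arccos (x \<bullet> y) = 0 \<longleftrightarrow> x = y"
  using assms inner_unit_eq_1[OF assms] abs_inner_unit_le_1[OF assms]
  by (metis abs_one arccos_1 arccos_eq_iff dot_square_norm order_refl power_one)

lemma arccos_abs_bounds:
  assumes "\<bar>c\<bar> \<le> 1"
  shows "0 \<le> arccos c" "arccos c \<le> pi" "0 \<le> arccos \<bar>c\<bar>" "arccos \<bar>c\<bar> \<le> pi / 2"
    "arccos \<bar>c\<bar> \<le> arccos c"
  using assms arccos_le_pi2[of "\<bar>c\<bar>"]
  by (auto simp: abs_le_iff arccos_lbound arccos_ubound arccos_le_mono)

lemma Metric_space_sphere: "Metric_space (sphere (0::'a::real_inner) 1) sphere_dist"
proof (rule Metric_space.intro)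
  fix x y :: 'a
  show "0 \<le> sphere_dist x y"
    using arccos_abs_bounds(1) abs_inner_unit_le_1[of x y] by (simp add: sphere_dist_def)
qed (auto simp: sphere_dist_def inner_commute arccos_inner_eq_0_iff arccos_inner_triangle)

lemma
  shows mspace_sphere_metric: "mspace sphere_metric = sphere (0::'a::real_inner) 1"
    and mdist_sphere_metric: "mdist sphere_metric = (sphere_dist :: 'a::real_inner \<Rightarrow> 'a \<Rightarrow> real)"
  by (simp_all add: sphere_metric_def Metric_space.mspace_metric[OF Metric_space_sphere]
      Metric_space.mdist_metric[OF Metric_space_sphere])

lemma mtopology_of_sphere_metric:
  "mtopology_of sphere_metric = top_of_set (sphere (0::'a::real_inner) 1)"
proof -
  interpret S: Metric_space "sphere (0::'a) 1" sphere_dist by (rule Metric_space_sphere)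
  have sq: "(dist x y)\<^sup>2 = 2 - 2 * cos (sphere_dist x y)"
    if "x \<in> sphere 0 1" "y \<in> sphere 0 1" for x y :: 'a
  proof -
    have "x \<bullet> x = 1" "y \<bullet> y = 1" "- 1 \<le> x \<bullet> y" "x \<bullet> y \<le> 1"
      using that abs_inner_unit_le_1[of x y] by (auto simp: dot_square_norm abs_le_iff)
    then show ?thesis
      using that by (simp add: dist_norm power2_norm_eq_inner inner_diff inner_commute sphere_dist_def)
  qed
  have le_pi: "sphere_dist x y \<le> pi" for x y :: 'a
    using arccos_abs_bounds(2) abs_inner_unit_le_1[of x y] by (simp add: sphere_dist_def)
  have "openin S.mtopology U \<longleftrightarrow> openin (top_of_set (sphere 0 1)) U" for U
  proof -
    have "(\<exists>r>0. S.mball x r \<subseteq> U) \<longleftrightarrow> (\<exists>e>0. \<forall>y\<in>sphere 0 1. dist y x < e \<longrightarrow> y \<in> U)"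
      if x: "x \<in> sphere 0 1" for x
    proof
      assume "\<exists>r>0. S.mball x r \<subseteq> U"
      then obtain r where r: "r > 0" "S.mball x r \<subseteq> U" by blast
      define s where "s = min r pi"
      have s: "0 < s" "s \<le> pi" using r by (auto simp: s_def)
      then have "cos s < 1" using cos_monotone_0_pi[of 0 s] by simp
      have "y \<in> U" if y: "y \<in> sphere 0 1" "dist y x < sqrt (2 - 2 * cos s)" for y
      proof -
        have "(dist y x)\<^sup>2 < 2 - 2 * cos s"
          using y(2) by (metis real_less_rsqrt real_sqrt_abs real_sqrt_less_iff abs_of_nonneg zero_le_dist)
        then have "cos s < cos (sphere_dist x y)"
          using sq[OF x y(1)] by (simp add: dist_commute)
        then have "sphere_dist x y < s"
          using s cos_monotone_0_pi_le[of s "sphere_dist x y"] le_pi[of x y] by linarith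
        then show ?thesis using r(2) x y(1) by (auto simp: s_def)
      qed
      then show "\<exists>e>0. \<forall>y\<in>sphere 0 1. dist y x < e \<longrightarrow> y \<in> U"
        using \<open>cos s < 1\<close> by (intro exI[of _ "sqrt (2 - 2 * cos s)"]) auto
    next
      assume "\<exists>e>0. \<forall>y\<in>sphere 0 1. dist y x < e \<longrightarrow> y \<in> U"
      then obtain e where e: "e > 0" "\<And>y. y \<in> sphere 0 1 \<Longrightarrow> dist y x < e \<Longrightarrow> y \<in> U" by blast
      have "((\<lambda>t. 2 - 2 * cos t) \<longlongrightarrow> 2 - 2 * cos 0) (at (0::real))"
        by (intro tendsto_intros)
      then have "eventually (\<lambda>t. 2 - 2 * cos t < e\<^sup>2) (at (0::real))"
        using e(1) by (intro order_tendstoD(2)) auto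
      then obtain r where r: "r > 0" "\<And>t::real. t \<noteq> 0 \<Longrightarrow> dist t 0 < r \<Longrightarrow> 2 - 2 * cos t < e\<^sup>2"
        by (auto simp: eventually_at)
      have "y \<in> U" if y: "y \<in> S.mball x r" for y
      proof (cases "y = x")
        case True
        then show ?thesis using e x by simp
      next
        case False
        then have "0 < sphere_dist x y" using x y by (intro S.mdist_pos_less) auto
        then have "(dist x y)\<^sup>2 < e\<^sup>2" using r(2)[of "sphere_dist x y"] x y sq[of x y] by auto
        then have "dist x y < e" using e(1) by (simp add: power2_less_imp_less)
        then show ?thesis using e(2) y by (simp add: dist_commute)
      qed
      then show "\<exists>r>0. S.mball x r \<subseteq> U" using r(1) by blast
    qed
    then show ?thesis
      unfolding S.openin_mtopology openin_euclidean_subtopology_iff by (meson subsetD)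
  qed
  then show ?thesis
    by (simp add: sphere_metric_def topology_eq)
qed

lemma span_Int_sphere:
  fixes x :: "'a::real_inner"
  assumes "norm x = 1"
  shows "span {x} \<inter> sphere 0 1 = {x, - x}"
  using assms by (auto simp: span_singleton abs_if split: if_splits
      intro: range_eqI[of _ _ 1] range_eqI[of _ _ "-1"])

lemma line_angle_span:
  fixes x y :: "'a::real_inner"
  assumes "norm x = 1" "norm y = 1"
  shows "line_angle (span {x}) (span {y}) = arccos \<bar>x \<bullet> y\<bar>"
proof -
  have c: "\<bar>x \<bullet> y\<bar> \<le> 1" using assms by (rule abs_inner_unit_le_1)
  have lines: "span {x} \<in> lines_through_0" "span {y} \<in> lines_through_0"
    using assms by (auto simp: lines_through_0_def)
  have gt: "arccos c \<le> pi / 2 \<Longrightarrow> 0 \<le> c" if "\<bar>c\<bar> \<le> 1" for c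
    using that arccos_le_mono[of c 0] by simp
  have "(THE \<theta>. \<theta> \<in> {0..pi/2} \<and>
      (\<exists>u\<in>{x, - x}. \<exists>v\<in>{y, - y}. \<theta> = arccos (u \<bullet> v))) = arccos \<bar>x \<bullet> y\<bar>"
  proof (rule the_equality)
    show "arccos \<bar>x \<bullet> y\<bar> \<in> {0..pi/2} \<and>
        (\<exists>u\<in>{x, - x}. \<exists>v\<in>{y, - y}. arccos \<bar>x \<bullet> y\<bar> = arccos (u \<bullet> v))"
      using arccos_abs_bounds[OF c] by (auto simp: abs_if)
  next
    fix \<theta>
    assume "\<theta> \<in> {0..pi/2} \<and> (\<exists>u\<in>{x, - x}. \<exists>v\<in>{y, - y}. \<theta> = arccos (u \<bullet> v))"
    then have "\<theta> \<le> pi / 2" "\<theta> = arccos (x \<bullet> y) \<or> \<theta> = arccos (- (x \<bullet> y))" by auto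
    then show "\<theta> = arccos \<bar>x \<bullet> y\<bar>"
      using gt[of "x \<bullet> y"] gt[of "- (x \<bullet> y)"] c by fastforce
  qed
  then show ?thesis
    using lines by (simp add: line_angle_def span_Int_sphere assms)
qed

lemma Metric_space_lines: "Metric_space (lines_through_0 :: 'a::real_inner set set) line_angle"
proof (rule Metric_space.intro)
  fix K L :: "'a set"
  show "0 \<le> line_angle K L"
  proof (cases "K \<in> lines_through_0 \<and> L \<in> lines_through_0")
    case True
    then show ?thesis
      by (auto simp: lines_through_0_def line_angle_span abs_inner_unit_le_1 arccos_abs_bounds)
  next
    case False
    then show ?thesis by (auto simp: line_angle_def)
  qed
  show "line_angle K L = line_angle L K"
  proof (cases "K \<in> lines_through_0 \<and> L \<in> lines_through_0")
    case True
    then show ?thesis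
      by (auto simp: lines_through_0_def line_angle_span inner_commute)
  next
    case False
    then show ?thesis by (auto simp: line_angle_def)
  qed
next
  fix K L :: "'a set"
  assume "K \<in> lines_through_0" "L \<in> lines_through_0"
  then obtain x y where xy: "norm x = 1" "norm y = 1" "K = span {x}" "L = span {y}"
    by (auto simp: lines_through_0_def)
  have "arccos \<bar>x \<bullet> y\<bar> = 0 \<longleftrightarrow> x = y \<or> x = - y"
    using arccos_inner_eq_0_iff[of x y] arccos_inner_eq_0_iff[of x "- y"] xy
      arccos_eq_iff[of "\<bar>x \<bullet> y\<bar>" 1] abs_inner_unit_le_1[of x y] inner_unit_eq_1[of x y]
      inner_unit_eq_1[of x "- y"]
    by (auto simp: abs_if dot_square_norm split: if_splits)
  also have "\<dots> \<longleftrightarrow> span {x} = span {y}"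
  proof
    assume "span {x} = span {y}"
    then have "{x, - x} = {y, - y}" using span_Int_sphere xy by metis
    then show "x = y \<or> x = - y" by (auto simp: doubleton_eq_iff)
  next
    assume "x = y \<or> x = - y"
    moreover have "span {- y} = span {y}"
      using span_neg[OF span_base, of "- y" "{- y}"]
      by (auto simp: span_eq intro: span_neg span_base)
    ultimately show "span {x} = span {y}" by auto
  qed
  finally show "line_angle K L = 0 \<longleftrightarrow> K = L"
    using xy by (simp add: line_angle_span)
next
  fix K L M :: "'a set"
  assume "K \<in> lines_through_0" "L \<in> lines_through_0" "M \<in> lines_through_0"
  then obtain x y z where xyz: "norm x = 1" "norm y = 1" "norm z = 1"
      "K = span {x}" "L = span {y}" "M = span {z}"
    by (auto simp: lines_through_0_def)
  define u v where "u = (if x \<bullet> y < 0 then - x else x)" and "v = (if y \<bullet> z < 0 then - z else z)"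
  have uv: "norm u = 1" "norm v = 1" "\<bar>x \<bullet> y\<bar> = u \<bullet> y" "\<bar>y \<bullet> z\<bar> = y \<bullet> v" "\<bar>x \<bullet> z\<bar> = \<bar>u \<bullet> v\<bar>"
    using xyz by (auto simp: u_def v_def)
  have "arccos \<bar>u \<bullet> v\<bar> \<le> arccos (u \<bullet> v)"
    using arccos_abs_bounds(5) abs_inner_unit_le_1 uv by blast
  also have "\<dots> \<le> arccos (u \<bullet> y) + arccos (y \<bullet> v)"
    using xyz uv by (intro arccos_inner_triangle)
  finally show "line_angle K M \<le> line_angle K L + line_angle L M"
    using xyz uv by (simp add: line_angle_span)
qed

lemma
  shows mspace_projective_metric: "mspace projective_metric = (lines_through_0 :: 'a::real_inner set set)"
    and mdist_projective_metric: "mdist projective_metric = (line_angle :: 'a::real_inner set \<Rightarrow> 'a set \<Rightarrow> real)"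
  by (simp_all add: projective_metric_def Metric_space.mspace_metric[OF Metric_space_lines]
      Metric_space.mdist_metric[OF Metric_space_lines])

end

theory Submission
  imports Defs
begin

text \<open>
  Suppose that no \<open>A i\<close> contains an antipodal pair.  For each of the first \<open>n\<close> sets, the difference of
  the distances of \<open>x\<close> to \<open>- A i\<close> and to \<open>A i\<close> is continuous and odd in \<open>x\<close>, and it is positive on \<open>A i\<close>:
  there the second distance vanishes, and the first does not because \<open>A i\<close> is disjoint from \<open>- A i\<close> and
  open or closed (\<open>infdist_antipode_pos\<close>).  The \<open>n\<close> differences form an odd map \<open>f\<close> to \<open>\<real>\<^sup>n\<close>.  Some set \<open>B\<close>
  of diameter at most \<open>c\<^sub>n\<close> satisfies \<open>0 \<in> conv (f B)\<close>, and by oddness so does \<open>- B\<close>.  Both lie in members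
  of the cover, but neither can lie in one of the first \<open>n\<close> sets, since a coordinate of \<open>f\<close> is
  positive on that set.  So both lie in \<open>A (n + 1)\<close>, which then contains an antipodal pair after all
  (\<open>antipodes_from_small_sets\<close>).

  The existence of \<open>B\<close> requires that the infimum defining \<open>c\<^sub>n\<close> is attained for each single map \<open>f\<close>
  (\<open>Z2_caratheodory_sphere_attained\<close>).  By Caratheodory's theorem a set with \<open>0\<close> in the convex hull of
  its image may be replaced by \<open>n + 1\<close> of its points with convex weights.  Points and weights range
  over a compact space, so configurations whose diameters approach \<open>c\<^sub>n\<close> have a limit of diameter at
  most \<open>c\<^sub>n\<close> (\<open>convex_hull_limit_of_small_sets\<close>).

  The parenthetical condition suffices because \<open>c\<^sub>n\<close> is at most \<open>\<pi>\<close> minus the packing number.  Take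
  unit vectors spanning \<open>n + 1\<close> lines with pairwise angles at least \<open>\<epsilon>\<close>.  Their images under an odd map to
  \<open>\<real>\<^sup>n\<close> are linearly dependent, and replacing a vector by its antipode flips the sign of its
  coefficient, so with suitable signs \<open>0\<close> is a convex combination of the images.  Whatever the
  signs, the chosen vectors have pairwise angles at most \<open>\<pi> - \<epsilon>\<close>
  (\<open>Z2_caratheodory_le_of_separated_lines\<close>).
\<close>

section \<open>Diameters and convex combinations on the sphere\<close>

lemma mdiameter_sphere_le_iff:
  fixes A :: "'a::real_inner set"
  assumes "A \<subseteq> sphere 0 1" "A \<noteq> {}"
  shows "mdiameter sphere_metric A \<le> t \<longleftrightarrow> (\<forall>x\<in>A. \<forall>y\<in>A. arccos (x \<bullet> y) \<le> t)"
proof -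
  have eq: "mdist sphere_metric x y = arccos (x \<bullet> y)" if "x \<in> A" "y \<in> A" for x y
    using that assms by (auto simp: mdist_sphere_metric sphere_dist_def)
  have "bdd_above ((\<lambda>(x, y). mdist sphere_metric x y) ` (A \<times> A))"
  proof (rule bdd_aboveI2[where M = pi], clarify)
    fix x y assume "x \<in> A" "y \<in> A"
    then show "mdist sphere_metric x y \<le> pi"
      using assms eq by (auto intro!: arccos_abs_bounds abs_inner_unit_le_1)
  qed
  then have "mdiameter sphere_metric A \<le> t \<longleftrightarrow> (\<forall>(x, y)\<in>A \<times> A. mdist sphere_metric x y \<le> t)"
    using assms by (simp add: mdiameter_def cSUP_le_iff case_prod_unfold)
  then show ?thesis using eq by auto
qed

text \<open>
  Caratheodory's theorem in a form suited to limits: the number of points and weights is always the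
  same, so that they become coordinates of vectors.  The index type \<^typ>\<open>'n option\<close> has
  \<open>CARD('n) + 1\<close> elements; superfluous indices carry weight \<open>0\<close> and an arbitrary point of \<open>A\<close>.
\<close>

lemma caratheodory_indexed:
  fixes f :: "'a \<Rightarrow> real^'n"
  assumes "y \<in> convex hull (f ` A)"
  obtains u :: "real^('n option)" and x :: "'a^('n option)"
  where "\<And>i. 0 \<le> u $ i" "(\<Sum>i\<in>UNIV. u $ i) = 1" "\<And>i. x $ i \<in> A"
    "(\<Sum>i\<in>UNIV. (u $ i) *\<^sub>R f (x $ i)) = y"
proof -
  from assms[unfolded convex_hull_caratheodory] obtain T v
    where T: "finite T" "T \<subseteq> f ` A" "card T \<le> CARD('n option)"
      and v: "\<forall>z\<in>T. 0 \<le> v z" "sum v T = 1" "(\<Sum>z\<in>T. v z *\<^sub>R z) = y"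
    by auto
  have "\<exists>h :: _ \<Rightarrow> 'n option. h ` T \<subseteq> UNIV \<and> inj_on h T"
    using T by (intro card_le_inj) auto
  then obtain h :: "real^'n \<Rightarrow> 'n option" where h: "inj_on h T" by auto
  have "T \<noteq> {}" using v(2) by auto
  then obtain a where a: "a \<in> A" using T(2) by auto
  have "\<forall>z\<in>T. \<exists>a. a \<in> A \<and> f a = z" using T(2) by auto
  from bchoice[OF this] obtain p where p: "\<forall>z\<in>T. p z \<in> A \<and> f (p z) = z" by blast
  define u :: "real^('n option)" where "u = (\<chi> i. if i \<in> h ` T then v (inv_into T h i) else 0)"
  define x :: "'a^('n option)" where "x = (\<chi> i. if i \<in> h ` T then p (inv_into T h i) else a)"
  have inv_h: "inv_into T h (h z) = z" if "z \<in> T" for z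
    using that h by simp
  have ux: "u $ h z = v z" "x $ h z = p z" if "z \<in> T" for z
    using that inv_h by (auto simp: u_def x_def)
  have sum_eq: "(\<Sum>i\<in>UNIV. g i) = (\<Sum>z\<in>T. g (h z))" if "\<And>i. i \<notin> h ` T \<Longrightarrow> g i = 0"
    for g :: "'n option \<Rightarrow> 'c::comm_monoid_add"
  proof -
    have "(\<Sum>i\<in>UNIV. g i) = (\<Sum>i\<in>h ` T. g i)"
      using that by (intro sum.mono_neutral_right) auto
    then show ?thesis using h by (simp add: sum.reindex)
  qed
  show thesis
  proof
    show "0 \<le> u $ i" for i using v(1) inv_h by (auto simp: u_def)
    show "x $ i \<in> A" for i using p a inv_h by (auto simp: x_def)
    show "(\<Sum>i\<in>UNIV. u $ i) = 1"
      using v(2) by (subst sum_eq) (auto simp: u_def inv_h)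
    show "(\<Sum>i\<in>UNIV. (u $ i) *\<^sub>R f (x $ i)) = y"
    proof (subst sum_eq)
      show "(\<Sum>z\<in>T. u $ h z *\<^sub>R f (x $ h z)) = y"
        unfolding v(3)[symmetric] using p by (intro sum.cong refl) (simp add: ux)
    qed (auto simp: u_def)
  qed
qed

lemma compact_vec_all:
  fixes S :: "'a::euclidean_space set"
  assumes "compact S"
  shows "compact {x :: 'a^'i. \<forall>i. x $ i \<in> S}"
proof -
  have "closed (\<Inter>i. (\<lambda>x :: 'a^'i. x $ i) -` S)"
    using assms by (intro closed_INT ballI closed_vimage compact_imp_closed continuous_on_component continuous_on_id)
  moreover obtain B where B: "\<And>x. x \<in> S \<Longrightarrow> norm x \<le> B"
    using compact_imp_bounded[OF assms] unfolding bounded_iff by auto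
  have "norm x \<le> (\<Sum>i\<in>(UNIV :: 'i set). B)" if "\<forall>i. x $ i \<in> S" for x :: "'a^'i"
    unfolding norm_vec_def using B that
    by (intro order_trans[OF L2_set_le_sum] sum_mono) auto
  then have "bounded {x :: 'a^'i. \<forall>i. x $ i \<in> S}"
    unfolding bounded_iff by blast
  ultimately show ?thesis
    by (simp add: compact_eq_bounded_closed vimage_def Collect_all_eq)
qed

text \<open>
  The convex combinations given by \<open>caratheodory_indexed\<close> lie in the product of a cube of weights and a
  power of \<open>S\<close>, so they have a convergent subsequence, and the points of the limit form the set \<open>B\<close>.
  The function \<open>D\<close> plays the role of the metric.
\<close>

lemma convex_hull_limit_of_small_sets:
  fixes S :: "'a::euclidean_space set" and f :: "'a \<Rightarrow> real^'n" and t :: "nat \<Rightarrow> real"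
  assumes S: "compact S" and f: "continuous_on S f" and D: "continuous_on (S \<times> S) D"
    and A: "\<And>k. A k \<subseteq> S" "\<And>k x y. x \<in> A k \<Longrightarrow> y \<in> A k \<Longrightarrow> D (x, y) \<le> t k"
    and z: "\<And>k. z \<in> convex hull (f ` A k)" and t: "t \<longlonglongrightarrow> c"
  obtains B where "B \<subseteq> S" "\<And>x y. x \<in> B \<Longrightarrow> y \<in> B \<Longrightarrow> D (x, y) \<le> c" "z \<in> convex hull (f ` B)"
proof -
  define P where "P k u x \<longleftrightarrow> (\<forall>i. 0 \<le> u $ i) \<and> (\<Sum>i\<in>UNIV. u $ i) = 1 \<and> (\<forall>i. x $ i \<in> A k) \<and>
      (\<Sum>i\<in>UNIV. (u $ i) *\<^sub>R f (x $ i)) = z" for k and u :: "real^('n option)" and x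
  have "\<exists>u x. P k u x" for k
    unfolding P_def by (rule caratheodory_indexed[OF z[of k]]) (intro exI conjI allI; assumption)
  then obtain u x where "\<And>k. P k (u k) (x k)" by metis
  then have u: "\<And>k i. 0 \<le> u k $ i" "\<And>k. (\<Sum>i\<in>UNIV. u k $ i) = 1"
    and x: "\<And>k i. x k $ i \<in> A k"
    and ux: "\<And>k. (\<Sum>i\<in>UNIV. (u k $ i) *\<^sub>R f (x k $ i)) = z"
    unfolding P_def by blast+
  have "u k $ i \<le> 1" for k i
    using u member_le_sum[of i UNIV "\<lambda>i. u k $ i"] by auto
  with u A x have "(u k, x k) \<in> {u. \<forall>i. u $ i \<in> {0..1}} \<times> {x. \<forall>i. x $ i \<in> S}" for k
    by fastforce
  moreover have "compact ({u :: real^('n option). \<forall>i. u $ i \<in> {0..1}} \<times> {x :: 'a^('n option). \<forall>i. x $ i \<in> S})"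
    using S by (intro compact_Times compact_vec_all) auto
  ultimately obtain l r
    where l: "l \<in> {u. \<forall>i. u $ i \<in> {0..1}} \<times> {x :: 'a^('n option). \<forall>i. x $ i \<in> S}"
      and r: "strict_mono r" and lim: "((\<lambda>k. (u k, x k)) \<circ> r) \<longlonglongrightarrow> l"
    unfolding compact_def by meson
  obtain v y where vy: "l = (v, y)" by (cases l)
  from l vy have v: "\<And>i. 0 \<le> v $ i" and y: "\<And>i. y $ i \<in> S" by auto
  have vlim: "(\<lambda>k. u (r k) $ i) \<longlonglongrightarrow> v $ i" and ylim: "(\<lambda>k. x (r k) $ i) \<longlonglongrightarrow> y $ i" for i
    using tendsto_fst[OF lim] tendsto_snd[OF lim] vy
    by (auto simp: o_def intro: tendsto_vec_nth)
  have xS: "x k $ i \<in> S" for k i using x A by blast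
  have flim: "(\<lambda>k. f (x (r k) $ i)) \<longlonglongrightarrow> f (y $ i)" for i
    by (rule continuous_on_tendsto_compose[OF f ylim y]) (simp add: xS)
  show thesis
  proof
    show "range (($) y) \<subseteq> S" using y by auto
  next
    fix a b assume "a \<in> range (($) y)" "b \<in> range (($) y)"
    then obtain i j where ij: "a = y $ i" "b = y $ j" by auto
    have "(\<lambda>k. D (x (r k) $ i, x (r k) $ j)) \<longlonglongrightarrow> D (y $ i, y $ j)"
      by (rule continuous_on_tendsto_compose[OF D tendsto_Pair[OF ylim ylim]]) (simp_all add: xS y)
    moreover have "(\<lambda>k. t (r k)) \<longlonglongrightarrow> c"
      using LIMSEQ_subseq_LIMSEQ[OF t r] by (simp add: o_def)
    ultimately show "D (a, b) \<le> c"
      unfolding ij by (rule LIMSEQ_le) (use A x in auto)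
  next
    have "(\<lambda>k. \<Sum>i\<in>UNIV. u (r k) $ i) \<longlonglongrightarrow> (\<Sum>i\<in>UNIV. v $ i)"
      by (intro tendsto_sum vlim)
    then have "(\<Sum>i\<in>UNIV. v $ i) = 1" by (simp add: u LIMSEQ_const_iff)
    then have "(\<Sum>i\<in>UNIV. (v $ i) *\<^sub>R f (y $ i)) \<in> convex hull (f ` range (($) y))"
      using v by (intro convex_sum) (auto intro: hull_inc)
    moreover have "(\<lambda>k. \<Sum>i\<in>UNIV. (u (r k) $ i) *\<^sub>R f (x (r k) $ i)) \<longlonglongrightarrow> (\<Sum>i\<in>UNIV. (v $ i) *\<^sub>R f (y $ i))"
      by (intro tendsto_sum tendsto_scaleR vlim flim)
    then have "(\<Sum>i\<in>UNIV. (v $ i) *\<^sub>R f (y $ i)) = z" by (simp add: ux LIMSEQ_const_iff)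
    ultimately show "z \<in> convex hull (f ` range (($) y))" by simp
  qed
qed

section \<open>The infimum defining the Caratheodory number is attained\<close>

text \<open>The set of which the Caratheodory number of the sphere is the infimum.\<close>

definition sphere_witness_bounds :: "'n::finite itself \<Rightarrow> 'a::real_inner itself \<Rightarrow> real set" where
  "sphere_witness_bounds _ _ = {t. 0 \<le> t \<and>
     (\<forall>f :: 'a \<Rightarrow> real^'n. continuous_on (sphere 0 1) f \<and> (\<forall>x\<in>sphere 0 1. f (- x) = - f x)
        \<longrightarrow> (\<exists>A \<subseteq> sphere 0 1. mdiameter sphere_metric A \<le> t \<and> 0 \<in> convex hull (f ` A)))}"

lemma Z2_caratheodory_sphere:
  "Z2_caratheodory TYPE('n::finite) (sphere_metric :: 'a::real_inner metric) uminus
    = Inf (sphere_witness_bounds TYPE('n) TYPE('a))"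
  by (simp only: Z2_caratheodory_def sphere_witness_bounds_def mtopology_of_sphere_metric
      mspace_sphere_metric continuous_map_iff_continuous)

lemma bdd_below_sphere_witness_bounds: "bdd_below (sphere_witness_bounds TYPE('n::finite) TYPE('a::real_inner))"
  by (rule bdd_belowI[of _ 0]) (simp add: sphere_witness_bounds_def)

text \<open>
  An antipodal pair \<open>{b, - b}\<close> serves every odd map, with \<open>0\<close> as the midpoint of the two images.
\<close>

lemma pi_in_sphere_witness_bounds:
  "pi \<in> sphere_witness_bounds TYPE('n::finite) TYPE('a::euclidean_space)"
proof -
  have "\<exists>A \<subseteq> sphere 0 1. mdiameter sphere_metric A \<le> pi \<and> 0 \<in> convex hull (f ` A)"
    if "\<forall>x\<in>sphere 0 1. f (- x) = - f x" for f :: "'a \<Rightarrow> real^'n"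
  proof -
    obtain b :: 'a where b: "norm b = 1" using vector_choose_size[of 1] by auto
    have "0 \<in> convex hull (f ` {b, - b})"
      using b that convexD_alt[OF convex_convex_hull, of "f b" "{f b, - f b}" "- f b" "1/2"]
      by (auto simp: hull_inc)
    moreover have "mdiameter sphere_metric {b, - b} \<le> pi"
      using b by (subst mdiameter_sphere_le_iff)
        (auto intro!: arccos_abs_bounds abs_inner_unit_le_1 simp del: inner_minus_left inner_minus_right)
    ultimately show ?thesis using b by (intro exI[of _ "{b, - b}"]) auto
  qed
  then show ?thesis by (simp add: sphere_witness_bounds_def)
qed

text \<open>
  For a fixed map, bounds arbitrarily close to the infimum provide sets \<open>A k\<close> of diameter at most
  \<open>c + 1 / Suc k\<close>; the limit lemma turns them into a set of diameter at most \<open>c\<close>.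
\<close>

lemma Z2_caratheodory_sphere_attained:
  fixes f :: "'a::euclidean_space \<Rightarrow> real^'n"
  assumes f: "continuous_on (sphere 0 1) f" and odd: "\<And>x. x \<in> sphere 0 1 \<Longrightarrow> f (- x) = - f x"
  obtains B where "B \<subseteq> sphere 0 1" "0 \<in> convex hull (f ` B)"
    "mdiameter sphere_metric B \<le> Z2_caratheodory TYPE('n) (sphere_metric :: 'a metric) uminus"
proof -
  define c where "c = Z2_caratheodory TYPE('n) (sphere_metric :: 'a metric) uminus"
  have "\<exists>A \<subseteq> sphere 0 1. (\<forall>x\<in>A. \<forall>y\<in>A. arccos (x \<bullet> y) \<le> c + 1 / Suc k) \<and> 0 \<in> convex hull (f ` A)" for k
  proof -
    have "c < c + 1 / Suc k" by simp
    then obtain s where s: "s \<in> sphere_witness_bounds TYPE('n) TYPE('a)" "s < c + 1 / Suc k"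
      using cInf_lessD[of "sphere_witness_bounds TYPE('n) TYPE('a)"] pi_in_sphere_witness_bounds
      unfolding c_def Z2_caratheodory_sphere by blast
    then obtain A where A: "A \<subseteq> sphere 0 1" "mdiameter sphere_metric A \<le> s" "0 \<in> convex hull (f ` A)"
      using f odd unfolding sphere_witness_bounds_def by blast
    then have "A \<noteq> {}" by auto
    then have "\<forall>x\<in>A. \<forall>y\<in>A. arccos (x \<bullet> y) \<le> s" using A mdiameter_sphere_le_iff by blast
    then show ?thesis using A s(2) by (intro exI[of _ A]) force
  qed
  then obtain A where A: "\<And>k. A k \<subseteq> sphere 0 1" "\<And>k. 0 \<in> convex hull (f ` A k)"
    "\<And>k x y. x \<in> A k \<Longrightarrow> y \<in> A k \<Longrightarrow> arccos (x \<bullet> y) \<le> c + 1 / Suc k"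
    by metis
  have lim: "(\<lambda>k. c + 1 / Suc k) \<longlonglongrightarrow> c"
    using tendsto_add[OF tendsto_const LIMSEQ_Suc[OF lim_1_over_n], of c] by simp
  have ip: "- 1 \<le> x \<bullet> y" "x \<bullet> y \<le> 1" if "norm x = 1" "norm y = 1" for x y :: 'a
    using abs_inner_unit_le_1[OF that] by linarith+
  have D: "continuous_on (sphere 0 1 \<times> sphere 0 1) (\<lambda>(x, y). arccos (x \<bullet> (y :: 'a)))"
    unfolding case_prod_unfold
    by (intro continuous_intros) (auto simp: ip)
  obtain B where B: "B \<subseteq> sphere 0 1" "\<And>x y. x \<in> B \<Longrightarrow> y \<in> B \<Longrightarrow> arccos (x \<bullet> y) \<le> c"
      "0 \<in> convex hull (f ` B)"
    using convex_hull_limit_of_small_sets[OF compact_sphere f D, of A, OF A(1) _ A(2) lim] A(3) by auto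
  then have "B \<noteq> {}" by auto
  with B show thesis using that mdiameter_sphere_le_iff[of B c] unfolding c_def by blast
qed

section \<open>Small sets force an antipodal pair\<close>

lemma infdist_uminus: "infdist (- x) (uminus ` A) = infdist x (A :: 'a::real_normed_vector set)"
  by (simp add: infdist_def image_image dist_minus)

text \<open>
  If \<open>A\<close> is closed, then \<open>- A\<close> is closed and misses \<open>x\<close>.  If \<open>A\<close> is relatively open, then an open set
  around \<open>x\<close> meets \<open>S\<close> only in \<open>A\<close> and hence misses \<open>- A\<close>.
\<close>

lemma infdist_antipode_pos:
  fixes A S :: "'a::real_normed_vector set"
  assumes S: "closed S" "\<And>x. x \<in> S \<Longrightarrow> - x \<in> S"
    and A: "openin (top_of_set S) A \<or> closedin (top_of_set S) A"
    and anti: "\<And>x. x \<in> A \<Longrightarrow> - x \<notin> A" and x: "x \<in> A"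
  shows "0 < infdist x (uminus ` A)"
proof -
  have sub: "A \<subseteq> S" using A openin_imp_subset closedin_imp_subset by blast
  have disj: "A \<inter> uminus ` A = {}" using anti by force
  have "x \<notin> closure (uminus ` A)"
  proof (cases "closedin (top_of_set S) A")
    case True
    then have "closed A" using S(1) by (rule closedin_closed_trans)
    then have "closed (uminus ` A)" by (rule closed_negations)
    then show ?thesis using x disj by (auto simp: closure_closed)
  next
    case False
    then obtain U where U: "open U" "A = S \<inter> U" using A openin_open by blast
    have "uminus ` A \<subseteq> S" using sub S(2) by auto
    then have "U \<inter> uminus ` A = {}" using U disj by blast
    then have "U \<inter> closure (uminus ` A) = {}" using U(1) open_Int_closure_eq_empty by blast
    then show ?thesis using U x by blast
  qed
  then show ?thesis
    using x in_closure_iff_infdist_zero[of "uminus ` A" x] infdist_nonneg[of x "uminus ` A"] by fastforce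
qed

text \<open>
  Nothing is known about the topology of \<open>A (n + 1)\<close>, and no coordinate of \<open>f\<close> detects it.  It is
  dealt with by applying the smallness hypothesis to \<open>- B\<close> as well as to \<open>B\<close>.
\<close>

lemma antipodes_from_small_sets:
  fixes A :: "nat \<Rightarrow> 'a::euclidean_space set"
  assumes n: "CARD('n::finite) = n"
    and cover: "(\<Union>i\<in>{1..n+1}. A i) = sphere 0 1"
    and oc: "\<forall>i\<in>{1..n}. openin (top_of_set (sphere 0 1)) (A i) \<or> closedin (top_of_set (sphere 0 1)) (A i)"
    and small: "\<And>B. B \<subseteq> sphere 0 1 \<Longrightarrow>
       mdiameter sphere_metric B \<le> Z2_caratheodory TYPE('n) (sphere_metric :: 'a metric) uminus \<Longrightarrow>
       \<exists>i\<in>{1..n+1}. B \<subseteq> A i"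
  shows "\<exists>i\<in>{1..n+1}. \<exists>x\<in>A i. - x \<in> A i"
proof (rule ccontr)
  assume "\<not> ?thesis"
  then have anti: "\<And>i x. i \<in> {1..n+1} \<Longrightarrow> x \<in> A i \<Longrightarrow> - x \<notin> A i" by blast
  obtain b :: "'n \<Rightarrow> nat" where b: "bij_betw b UNIV {1..n}"
    using finite_same_card_bij[of "UNIV :: 'n set" "{1..n}"] n by auto
  define f :: "'a \<Rightarrow> real^'n" where
    "f x = (\<chi> i. infdist x (uminus ` A (b i)) - infdist x (A (b i)))" for x
  have cont: "continuous_on (sphere 0 1) f"
    unfolding f_def by (intro continuous_intros)
  have odd: "f (- x) = - f x" for x
    using infdist_uminus[of "- x"] by (simp add: f_def vec_eq_iff infdist_uminus)
  have pos: "0 < f x $ i" if "x \<in> A (b i)" for x i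
  proof -
    have bi: "b i \<in> {1..n}" using b bij_betwE by blast
    then have "0 < infdist x (uminus ` A (b i))"
      using oc anti[of "b i"] that by (intro infdist_antipode_pos[of "sphere 0 1"]) auto
    then show ?thesis using that by (simp add: f_def)
  qed
  obtain B where B: "B \<subseteq> sphere 0 1" "0 \<in> convex hull (f ` B)"
      "mdiameter sphere_metric B \<le> Z2_caratheodory TYPE('n) (sphere_metric :: 'a metric) uminus"
    using Z2_caratheodory_sphere_attained[OF cont odd] by blast
  have ne: "B \<noteq> {}" using B(2) by auto
  \<comment> \<open>The image of a subset of \<open>A j\<close> lies in an open half-space bounded by a hyperplane through \<open>0\<close>.\<close>
  have no_hull: False if C: "C \<subseteq> A j" and j: "j \<in> {1..n}" and hull: "0 \<in> convex hull (f ` C)" for C j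
  proof -
    obtain i where i: "j = b i" using j b by (metis bij_betw_imp_surj_on imageE)
    have "f ` C \<subseteq> {v. axis i 1 \<bullet> v > 0}"
      using pos C i by (auto simp: inner_axis')
    then have "convex hull (f ` C) \<subseteq> {v. axis i 1 \<bullet> v > 0}"
      by (intro hull_minimal convex_halfspace_gt)
    then show False using hull by auto
  qed
  have mB: "uminus ` B \<subseteq> sphere 0 1" using B(1) by auto
  have "mdiameter sphere_metric (uminus ` B)
      \<le> Z2_caratheodory TYPE('n) (sphere_metric :: 'a metric) uminus"
    using B(3) ne mdiameter_sphere_le_iff[OF B(1) ne] mdiameter_sphere_le_iff[OF mB] by auto
  then obtain i j where ij: "i \<in> {1..n+1}" "B \<subseteq> A i" "j \<in> {1..n+1}" "uminus ` B \<subseteq> A j"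
    using small[OF B(1) B(3)] small[OF mB] by blast
  have "f ` uminus ` B = uminus ` (f ` B)" using odd by (simp add: image_image)
  moreover have "0 \<in> uminus ` (convex hull (f ` B))"
    using B(2) by (intro image_eqI[of _ _ 0]) auto
  ultimately have hull: "0 \<in> convex hull (f ` uminus ` B)"
    using convex_hull_linear_image[of uminus "f ` B"] by (simp add: linear_iff)
  have "i \<notin> {1..n}" using no_hull[OF ij(2) _ B(2)] by blast
  then have i: "i = n + 1" using ij(1) by auto
  have "j \<notin> {1..n}" using no_hull[OF ij(4) _ hull] by blast
  then have j: "j = n + 1" using ij(3) by auto
  obtain b where "b \<in> B" using ne by blast
  then have "b \<in> A i" "- b \<in> A i" using ij(2,4) i j by auto
  then show False using anti[OF ij(1)] by blast
qed

section \<open>Packings of lines bound the Caratheodory number\<close>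

text \<open>
  A nontrivial linear relation among the vectors \<open>f (x i)\<close> exists by dimension.  Its coefficients become
  nonnegative when \<open>x i\<close> is replaced by \<open>- x i\<close> wherever the coefficient is negative, and dividing by
  their sum makes the relation a convex combination.
\<close>

lemma exists_signs_zero_in_hull:
  fixes f :: "'a::real_vector \<Rightarrow> real^'n" and x :: "'i::finite \<Rightarrow> 'a"
  assumes card: "CARD('n) < CARD('i)" and odd: "\<And>i. f (- x i) = - f (x i)"
  obtains s where "\<And>i. s i = x i \<or> s i = - x i" "0 \<in> convex hull (f ` range s)"
proof -
  define g :: "real^'i \<Rightarrow> real^'n" where "g c = (\<Sum>i\<in>UNIV. (c $ i) *\<^sub>R f (x i))" for c
  have lin: "linear g"
    by (rule linearI) (simp_all add: g_def sum.distrib scaleR_sum_right algebra_simps)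
  have "\<not> inj g"
  proof
    assume "inj g"
    then have "dim (UNIV :: (real^'i) set) \<le> dim (UNIV :: (real^'n) set)"
      using lin by (metis dim_image_eq dim_subset span_UNIV subset_UNIV inj_on_subset)
    then show False using card by simp
  qed
  then obtain c where c: "g c = 0" "c \<noteq> 0" using linear_injective_0[OF lin] by auto
  define s where "s i = (if 0 \<le> c $ i then x i else - x i)" for i
  define w where "w = (\<Sum>i\<in>UNIV. \<bar>c $ i\<bar>)"
  obtain k where "c $ k \<noteq> 0" using c(2) by (auto simp: vec_eq_iff)
  then have w: "0 < w" unfolding w_def by (intro sum_pos2[of _ k]) auto
  have "\<bar>c $ i\<bar> *\<^sub>R f (s i) = (c $ i) *\<^sub>R f (x i)" for i
    by (simp add: s_def odd)
  then have "(\<Sum>i\<in>UNIV. (\<bar>c $ i\<bar> / w) *\<^sub>R f (s i)) = (1 / w) *\<^sub>R g c"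
    by (simp add: g_def scaleR_sum_right divide_inverse mult.commute flip: scaleR_scaleR)
  moreover have "(\<Sum>i\<in>UNIV. (\<bar>c $ i\<bar> / w) *\<^sub>R f (s i)) \<in> convex hull (f ` range s)"
    using w by (intro convex_sum) (auto intro: hull_inc simp: w_def simp flip: sum_divide_distrib)
  ultimately show thesis using c(1) that[of s] by (auto simp: s_def)
qed

text \<open>
  If two lines form an angle of at least \<open>\<epsilon>\<close>, then both angles between unit vectors spanning them lie
  between \<open>\<epsilon>\<close> and \<open>\<pi> - \<epsilon>\<close>.  Hence the bound survives the choice of signs made by
  \<open>exists_signs_zero_in_hull\<close>.
\<close>

lemma Z2_caratheodory_le_of_separated_lines:
  fixes L :: "nat \<Rightarrow> 'a::euclidean_space set"
  assumes n: "CARD('n::finite) = n"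
    and L: "\<And>i. i \<in> {1..n+1} \<Longrightarrow> L i \<in> lines_through_0"
    and sep: "\<And>i j. i \<in> {1..n+1} \<Longrightarrow> j \<in> {1..n+1} \<Longrightarrow> i \<noteq> j \<Longrightarrow> \<epsilon> \<le> line_angle (L i) (L j)"
  shows "Z2_caratheodory TYPE('n) (sphere_metric :: 'a metric) uminus \<le> pi - \<epsilon>"
proof -
  obtain b :: "'n option \<Rightarrow> nat" where b: "bij_betw b UNIV {1..n+1}"
    using finite_same_card_bij[of "UNIV :: 'n option set" "{1..n+1}"] n by auto
  have b_in: "b i \<in> {1..n+1}" for i using b bij_betwE by blast
  have b_ne: "i \<noteq> j \<Longrightarrow> b i \<noteq> b j" for i j using b by (simp add: bij_betw_def inj_eq)
  have "\<exists>x. norm x = 1 \<and> L (b i) = span {x}" for i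
    using L[OF b_in[of i]] by (auto simp: lines_through_0_def)
  then obtain x where x: "\<And>i. norm (x i) = 1" "\<And>i. L (b i) = span {x i}" by metis
  have ang: "\<epsilon> \<le> arccos \<bar>x i \<bullet> x j\<bar>" if "i \<noteq> j" for i j
    using sep[OF b_in b_in b_ne[OF that]] by (simp add: x line_angle_span)
  obtain k :: 'n where True by blast
  \<comment> \<open>There are at least two lines, and no angle between lines exceeds \<open>\<pi> / 2\<close>.\<close>
  have "\<epsilon> \<le> pi / 2"
    using ang[of None "Some k"] arccos_abs_bounds(4)[OF abs_inner_unit_le_1[OF x(1) x(1), of None "Some k"]]
    by simp
  have small: "arccos (s i \<bullet> s j) \<le> pi - \<epsilon>" if s: "\<And>i. s i = x i \<or> s i = - x i" for s i j
  proof (cases "i = j")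
    case True
    have "s i \<bullet> s i = 1" using s[of i] x(1)[of i] by (auto simp: dot_square_norm)
    then have "arccos (s i \<bullet> s j) = 0" using True by simp
    then show ?thesis using \<open>\<epsilon> \<le> pi / 2\<close> pi_gt_zero by linarith
  next
    case False
    have c: "\<bar>x i \<bullet> x j\<bar> \<le> 1" using x by (intro abs_inner_unit_le_1)
    have "s i \<bullet> s j = x i \<bullet> x j \<or> s i \<bullet> s j = - (x i \<bullet> x j)" using s[of i] s[of j] by auto
    then have "arccos (s i \<bullet> s j) \<le> arccos (- \<bar>x i \<bullet> x j\<bar>)"
      using c by (intro arccos_le_arccos) auto
    also have "\<dots> = pi - arccos \<bar>x i \<bullet> x j\<bar>" using c by (intro arccos_minus) auto
    finally show ?thesis using ang[OF False] by simp
  qed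
  have "\<exists>A \<subseteq> sphere 0 1. mdiameter sphere_metric A \<le> pi - \<epsilon> \<and> 0 \<in> convex hull (f ` A)"
    if "\<forall>x\<in>sphere 0 1. f (- x) = - f x" for f :: "'a \<Rightarrow> real^'n"
  proof -
    have "f (- x i) = - f (x i)" for i using that x by simp
    then obtain s where s: "\<And>i. s i = x i \<or> s i = - x i" "0 \<in> convex hull (f ` range s)"
      using exists_signs_zero_in_hull[of f x] by auto
    have sub: "range s \<subseteq> sphere 0 1"
    proof clarify
      fix i show "s i \<in> sphere 0 1" using s(1)[of i] x(1)[of i] by auto
    qed
    then have "mdiameter sphere_metric (range s) \<le> pi - \<epsilon>"
      using small[of s] s(1) by (subst mdiameter_sphere_le_iff) auto
    then show ?thesis using sub s(2) by blast
  qed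
  moreover have "\<epsilon> \<le> pi"
    using \<open>\<epsilon> \<le> pi / 2\<close> pi_gt_zero by linarith
  ultimately have "pi - \<epsilon> \<in> sphere_witness_bounds TYPE('n) TYPE('a)"
    by (simp add: sphere_witness_bounds_def)
  then show ?thesis
    unfolding Z2_caratheodory_sphere by (intro cInf_lower bdd_below_sphere_witness_bounds)
qed

text \<open>Each line meets the sphere in only two points, while the sphere is connected and thus infinite.\<close>

lemma infinite_lines_through_0:
  assumes "2 \<le> DIM('a::euclidean_space)"
  shows "infinite (lines_through_0 :: 'a set set)"
proof
  assume "finite (lines_through_0 :: 'a set set)"
  then have "finite (\<Union>L\<in>lines_through_0 :: 'a set set. L \<inter> sphere 0 1)"
    by (rule finite_UN_I) (auto simp: lines_through_0_def span_Int_sphere)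
  moreover have "(sphere 0 1 :: 'a set) \<subseteq> (\<Union>L\<in>lines_through_0. L \<inter> sphere 0 1)"
    by (auto simp: lines_through_0_def intro: span_base)
  ultimately have "finite (sphere 0 1 :: 'a set)" by (rule finite_subset[rotated])
  moreover obtain b :: 'a where b: "norm b = 1" using vector_choose_size[of 1] by auto
  then have "b \<noteq> 0" by auto
  then have "b \<noteq> - b"
    by (metis eq_neg_iff_add_eq_0 scaleR_2 scaleR_eq_0_iff zero_neq_numeral)
  then have "uncountable (sphere 0 1 :: 'a set)"
    using b by (intro connected_uncountable[of _ b "- b"] connected_sphere assms) auto
  ultimately show False using countable_finite by blast
qed

text \<open>
  This makes the set in the definition of \<^const>\<open>packing_number\<close> nonempty.  Otherwise the supremum of
  the empty set of reals, an arbitrary number, would stand in for the packing number.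
\<close>

lemma exists_separated_lines:
  assumes "2 \<le> DIM('a::euclidean_space)"
  obtains L :: "nat \<Rightarrow> 'a::euclidean_space set" and \<epsilon> where "0 < \<epsilon>" "\<And>i. i \<in> {1..m} \<Longrightarrow> L i \<in> lines_through_0"
    "\<And>i j. i \<in> {1..m} \<Longrightarrow> j \<in> {1..m} \<Longrightarrow> i \<noteq> j \<Longrightarrow> \<epsilon> \<le> line_angle (L i) (L j)"
proof -
  interpret P: Metric_space "lines_through_0 :: 'a set set" line_angle by (rule Metric_space_lines)
  obtain L :: "nat \<Rightarrow> 'a set" where L: "inj L" "range L \<subseteq> lines_through_0"
    using infinite_countable_subset[OF infinite_lines_through_0[OF assms]] by blast
  \<comment> \<open>The element \<open>1\<close> only keeps \<open>E\<close> nonempty when there are fewer than two lines.\<close>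
  define E where "E = insert 1 ((\<lambda>(i, j). line_angle (L i) (L j)) ` {(i, j)\<in>{1..m} \<times> {1..m}. i \<noteq> j})"
  have "finite {(i, j)\<in>{1..m} \<times> {1..m}. i \<noteq> j}"
    by (rule finite_subset[of _ "{1..m} \<times> {1..m}"]) auto
  then have "finite E" unfolding E_def by blast
  have "0 < e" if "e \<in> E" for e
    using that L by (auto simp: E_def inj_eq intro!: P.mdist_pos_less)
  then have "0 < Min E" using \<open>finite E\<close> by (subst Min_gr_iff) (auto simp: E_def)
  moreover have "Min E \<le> line_angle (L i) (L j)" if "i \<in> {1..m}" "j \<in> {1..m}" "i \<noteq> j" for i j
    using that \<open>finite E\<close> by (intro Min_le) (auto simp: E_def)
  ultimately show thesis using that[of "Min E" L] L(2) by blast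
qed

lemma Z2_caratheodory_le_packing:
  assumes n: "CARD('n::finite) = n" and dim: "2 \<le> DIM('a::euclidean_space)"
  shows "Z2_caratheodory TYPE('n) (sphere_metric :: 'a metric) uminus
    \<le> pi - packing_number (n + 1) (projective_metric :: 'a set metric)"
proof -
  define c where "c = Z2_caratheodory TYPE('n) (sphere_metric :: 'a metric) uminus"
  have "packing_number (n + 1) (projective_metric :: 'a set metric) \<le> pi - c"
    unfolding packing_number_def
  proof (rule cSup_least)
    show "{\<epsilon>. 0 < \<epsilon> \<and> (\<exists>x. (\<forall>i\<in>{1..n + 1}. x i \<in> mspace (projective_metric :: 'a set metric)) \<and>
        (\<forall>i\<in>{1..n + 1}. \<forall>j\<in>{1..n + 1}. i \<noteq> j \<longrightarrow> \<epsilon> \<le> mdist projective_metric (x i) (x j)))} \<noteq> {}"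
      using exists_separated_lines[OF dim, of "n + 1"]
      unfolding mspace_projective_metric mdist_projective_metric
      by (smt (verit, del_insts) empty_iff mem_Collect_eq)
  next
    fix \<epsilon>
    assume "\<epsilon> \<in> {\<epsilon>. 0 < \<epsilon> \<and> (\<exists>x. (\<forall>i\<in>{1..n + 1}. x i \<in> mspace (projective_metric :: 'a set metric)) \<and>
        (\<forall>i\<in>{1..n + 1}. \<forall>j\<in>{1..n + 1}. i \<noteq> j \<longrightarrow> \<epsilon> \<le> mdist projective_metric (x i) (x j)))}"
    then obtain L :: "nat \<Rightarrow> 'a set" where
      "\<forall>i\<in>{1..n+1}. L i \<in> lines_through_0"
      "\<forall>i\<in>{1..n+1}. \<forall>j\<in>{1..n+1}. i \<noteq> j \<longrightarrow> \<epsilon> \<le> line_angle (L i) (L j)"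
      unfolding mspace_projective_metric mdist_projective_metric by blast
    then have "c \<le> pi - \<epsilon>"
      unfolding c_def by (intro Z2_caratheodory_le_of_separated_lines[OF n, of L]) auto
    then show "\<epsilon> \<le> pi - c" by simp
  qed
  then show ?thesis unfolding c_def by simp
qed

theorem theorem15:
  fixes A :: "nat \<Rightarrow> (real^'s) set" and d n :: nat
  assumes "1 \<le> d" and "d \<le> n" and "CARD('s) = d + 1" and "CARD('n::finite) = n"
    and "(\<Union>i\<in>{1..n+1}. A i) = sphere 0 1"
    and "\<forall>i\<in>{1..n}. openin (top_of_set (sphere 0 1)) (A i) \<or> closedin (top_of_set (sphere 0 1)) (A i)"
  shows
    "((\<forall>B\<subseteq>sphere 0 1. mdiameter sphere_metric B \<le> Z2_caratheodory TYPE('n) (sphere_metric :: (real^'s) metric) uminus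
          \<longrightarrow> (\<exists>i\<in>{1..n+1}. B \<subseteq> A i))
       \<longrightarrow> (\<exists>i\<in>{1..n+1}. \<exists>x\<in>A i. - x \<in> A i))
     \<and>
     ((\<forall>B\<subseteq>sphere 0 1. mdiameter sphere_metric B \<le> pi - packing_number (n + 1) (projective_metric :: (real^'s) set metric)
          \<longrightarrow> (\<exists>i\<in>{1..n+1}. B \<subseteq> A i))
       \<longrightarrow> (\<forall>B\<subseteq>sphere 0 1. mdiameter sphere_metric B \<le> Z2_caratheodory TYPE('n) (sphere_metric :: (real^'s) metric) uminus
          \<longrightarrow> (\<exists>i\<in>{1..n+1}. B \<subseteq> A i)))"
proof (intro conjI impI)
  assume "\<forall>B\<subseteq>sphere 0 1. mdiameter sphere_metric B \<le> Z2_caratheodory TYPE('n) (sphere_metric :: (real^'s) metric) uminus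
      \<longrightarrow> (\<exists>i\<in>{1..n+1}. B \<subseteq> A i)"
  then show "\<exists>i\<in>{1..n+1}. \<exists>x\<in>A i. - x \<in> A i"
    using antipodes_from_small_sets[OF assms(4-6)] by blast
next
  assume small: "\<forall>B\<subseteq>sphere 0 1. mdiameter sphere_metric B \<le> pi - packing_number (n + 1) (projective_metric :: (real^'s) set metric)
      \<longrightarrow> (\<exists>i\<in>{1..n+1}. B \<subseteq> A i)"
  have "2 \<le> DIM(real^'s)" using assms(1,3) by simp
  from Z2_caratheodory_le_packing[OF assms(4) this] small
  show "\<forall>B\<subseteq>sphere 0 1. mdiameter sphere_metric B \<le> Z2_caratheodory TYPE('n) (sphere_metric :: (real^'s) metric) uminus
      \<longrightarrow> (\<exists>i\<in>{1..n+1}. B \<subseteq> A i)"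
    using order_trans by blast
qed

end
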